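(* The differentiation operator $\mathbf{D}:\mathcal{H}_+\to\mathcal{H}_+$ is (well defined and) continuous and satisfies $$\mathbf{D}(\mathcal{H}_+)=\mathcal{H}_{+,0}:=\Big\{\sum a_nn^{-s}\in\mathcal{H}_+: a_1=0\Big\}.$$
   Context: $\mathcal{H}_{+}$ is the space of Dirichlet series $D=\sum a_nn^{-s}$ such that $\|D\|_{2,k}:=\big(\sum_n|a_n|^2n^{-2/k}\big)^{1/2}<\infty$ for every $k\in\mathbb{N}$, with the Fréchet topology given by these seminorms. The differentiation operator is $\mathbf{D}\big(\sum_{n\ge1}a_nn^{-s}\big)=-\sum_{n\ge2}a_n\log(n)\,n^{-s}$ (the derivative of the function defined by the series). *)

theory Defs
  imports "HOL-Analysis.Analysis"
begin

text \<open>
  A Dirichlet series \<open>\<Sum>n\<ge>1. a\<^sub>n n\<^sup>-\<^sup>s\<close> is represented by its coefficient sequence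
  \<open>a :: nat \<Rightarrow> complex\<close>. The index 0 carries no term, so \<open>a 0 = 0\<close> is required
  in order that sequences correspond one-to-one to series.
\<close>

definition dirichlet_series :: "(nat \<Rightarrow> complex) set" where
  "dirichlet_series = {a. a 0 = 0}"

text \<open>
  Finiteness of the seminorm is \<open>seminorm_finite\<close>; the real number
  \<open>seminorm_2 k a\<close> is meaningful only under that condition.
\<close>

definition seminorm_finite :: "nat \<Rightarrow> (nat \<Rightarrow> complex) \<Rightarrow> bool" where
  "seminorm_finite k a \<longleftrightarrow>
     (\<lambda>n. (cmod (a n))\<^sup>2 * real n powr (- 2 / real k)) summable_on {1..}"

definition seminorm_2 :: "nat \<Rightarrow> (nat \<Rightarrow> complex) \<Rightarrow> real" where
  "seminorm_2 k a = sqrt (\<Sum>\<^sub>\<infinity>n\<in>{1..}. (cmod (a n))\<^sup>2 * real n powr (- 2 / real k))"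

definition H_plus :: "(nat \<Rightarrow> complex) set" where
  "H_plus = {a \<in> dirichlet_series. \<forall>k\<ge>1. seminorm_finite k a}"

definition H_plus_ball :: "nat \<Rightarrow> (nat \<Rightarrow> complex) \<Rightarrow> real \<Rightarrow> (nat \<Rightarrow> complex) set" where
  "H_plus_ball k a r = {b \<in> H_plus. seminorm_2 k (\<lambda>n. b n - a n) < r}"

text \<open>
  The locally convex topology given by a family of seminorms has all open seminorm balls
  as a subbasis.
\<close>

definition H_plus_topology :: "(nat \<Rightarrow> complex) topology" where
  "H_plus_topology =
     topology_generated_by {H_plus_ball k a r | k a r. k \<ge> 1 \<and> a \<in> H_plus \<and> r > 0}"

lemma topspace_H_plus_topology [simp]: "topspace H_plus_topology = H_plus"
proof -
  have "a \<in> H_plus_ball 1 a 1" if "a \<in> H_plus" for a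
    using that by (simp add: H_plus_ball_def seminorm_2_def)
  then have "H_plus \<subseteq> \<Union>{H_plus_ball k a r | k a r. k \<ge> 1 \<and> a \<in> H_plus \<and> r > 0}"
    by (fastforce intro: zero_less_one)
  moreover have "\<Union>{H_plus_ball k a r | k a r. k \<ge> 1 \<and> a \<in> H_plus \<and> r > 0} \<subseteq> H_plus"
    by (auto simp: H_plus_ball_def)
  ultimately show ?thesis
    unfolding H_plus_topology_def topology_generated_by_topspace by (rule antisym[rotated])
qed

text \<open>
  Termwise derivative in \<open>s\<close>: the derivative of \<open>n\<^sup>-\<^sup>s = exp (- s log n)\<close> is \<open>- log n \<cdot> n\<^sup>-\<^sup>s\<close>.
\<close>

definition diff_op :: "(nat \<Rightarrow> complex) \<Rightarrow> (nat \<Rightarrow> complex)" where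
  "diff_op a = (\<lambda>n. if n \<ge> 2 then - (a n * of_real (ln (real n))) else 0)"

definition H_plus_0 :: "(nat \<Rightarrow> complex) set" where
  "H_plus_0 = {a \<in> H_plus. a 1 = 0}"

end

theory Submission
  imports Defs
begin

text \<open>
  Since \<open>ln n \<le> 2k n\<^bsup>1/(2k)\<^esup>\<close>, differentiation is bounded from the \<open>2k\<close>-th to the \<open>k\<close>-th
  seminorm; dividing the coefficients by \<open>ln n \<ge> ln 2\<close> for \<open>n \<ge> 2\<close> is bounded in every seminorm
  and inverts it on the series without constant term.
\<close>

text \<open>With the weight inside the square, the seminorm becomes an l2 norm, so on finite index
  sets the library facts on \<open>L2_set\<close>, Minkowski's inequality among them, apply.\<close>

lemma weighted_square:
  "(cmod z)\<^sup>2 * real n powr (- 2 / real k) = (cmod z * real n powr (- 1 / real k))\<^sup>2"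
  by (simp add: power_mult_distrib power2_eq_square flip: powr_add)

text \<open>Finiteness matters: the infinite sum of a non-summable family defaults to 0, and then
  \<open>seminorm_2\<close> would bound nothing.\<close>

lemma L2_set_le_seminorm_2:
  assumes "seminorm_finite k a" "finite F" "F \<subseteq> {1..}"
  shows "L2_set (\<lambda>n. cmod (a n) * real n powr (- 1 / real k)) F \<le> seminorm_2 k a"
  using assms unfolding seminorm_finite_def seminorm_2_def L2_set_def weighted_square
  by (intro real_sqrt_le_mono finite_sum_le_infsum) auto

text \<open>The terms are nonnegative, so a uniform bound on finite partial sums yields both
  convergence and the bound on the limit. Estimates can thus be proved on finite sets only.\<close>

lemma seminorm_2_le:
  assumes "\<And>F. finite F \<Longrightarrow> F \<subseteq> {1..} \<Longrightarrow>
             L2_set (\<lambda>n. cmod (a n) * real n powr (- 1 / real k)) F \<le> M"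
  shows "seminorm_finite k a" and "seminorm_2 k a \<le> M"
proof -
  let ?f = "\<lambda>n. (cmod (a n) * real n powr (- 1 / real k))\<^sup>2"
  \<comment> \<open>The empty set gives the sign of \<open>M\<close>, without which a bound by the
    square of \<open>M\<close> would not pass to the square root.\<close>
  have "0 \<le> M"
    using assms[of "{}"] by simp
  have bound: "sum ?f F \<le> M\<^sup>2" if "finite F" "F \<subseteq> {1..}" for F
    using assms[OF that] unfolding L2_set_def by (rule sqrt_le_D)
  have summable: "?f summable_on {1..}"
  proof (rule nonneg_bdd_above_summable_on)
    show "bdd_above (sum ?f ` {F. F \<subseteq> {1..} \<and> finite F})"
      using bound by (intro bdd_aboveI2[where M = "M\<^sup>2"]) blast
  qed simp
  then show "seminorm_finite k a"
    unfolding seminorm_finite_def weighted_square .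
  have "infsum ?f {1..} \<le> M\<^sup>2"
    using summable bound by (rule infsum_le_finite_sums)
  then show "seminorm_2 k a \<le> M"
    unfolding seminorm_2_def weighted_square using \<open>0 \<le> M\<close> by (intro real_le_lsqrt)
qed

text \<open>Two indices are allowed because differentiation passes from index \<open>2 * k\<close>
  to \<open>k\<close>, while dividing by the logarithm keeps the index.\<close>

lemma seminorm_2_dominated:
  assumes "seminorm_finite j a" and "0 \<le> C"
    and "\<And>n. 1 \<le> n \<Longrightarrow>
          cmod (b n) * real n powr (- 1 / real k) \<le> C * (cmod (a n) * real n powr (- 1 / real j))"
  shows "seminorm_finite k b" and "seminorm_2 k b \<le> C * seminorm_2 j a"
proof -
  have "L2_set (\<lambda>n. cmod (b n) * real n powr (- 1 / real k)) F \<le> C * seminorm_2 j a"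
    if "finite F" "F \<subseteq> {1..}" for F
  proof -
    have "L2_set (\<lambda>n. cmod (b n) * real n powr (- 1 / real k)) F
        \<le> L2_set (\<lambda>n. C * (cmod (a n) * real n powr (- 1 / real j))) F"
      using that assms(3) by (intro L2_set_mono) auto
    also have "\<dots> = C * L2_set (\<lambda>n. cmod (a n) * real n powr (- 1 / real j)) F"
      using \<open>0 \<le> C\<close> by (simp add: L2_set_right_distrib)
    also have "\<dots> \<le> C * seminorm_2 j a"
      using L2_set_le_seminorm_2[OF assms(1) that] \<open>0 \<le> C\<close> by (rule mult_left_mono)
    finally show ?thesis .
  qed
  note bound = this
  show "seminorm_finite k b"
    using bound by (rule seminorm_2_le(1))
  show "seminorm_2 k b \<le> C * seminorm_2 j a"
    using bound by (rule seminorm_2_le(2))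
qed

lemma seminorm_2_add:
  assumes "seminorm_finite k a" and "seminorm_finite k b"
  shows "seminorm_finite k (\<lambda>n. a n + b n)"
    and "seminorm_2 k (\<lambda>n. a n + b n) \<le> seminorm_2 k a + seminorm_2 k b"
proof -
  have "L2_set (\<lambda>n. cmod (a n + b n) * real n powr (- 1 / real k)) F
      \<le> seminorm_2 k a + seminorm_2 k b"
    if "finite F" "F \<subseteq> {1..}" for F
  proof -
    have "L2_set (\<lambda>n. cmod (a n + b n) * real n powr (- 1 / real k)) F
        \<le> L2_set (\<lambda>n. cmod (a n) * real n powr (- 1 / real k)
                     + cmod (b n) * real n powr (- 1 / real k)) F"
      by (intro L2_set_mono)
        (auto simp: norm_triangle_ineq mult_right_mono simp flip: distrib_right)
    also have "\<dots> \<le> L2_set (\<lambda>n. cmod (a n) * real n powr (- 1 / real k)) F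
                  + L2_set (\<lambda>n. cmod (b n) * real n powr (- 1 / real k)) F"
      by (rule L2_set_triangle_ineq)
    also have "\<dots> \<le> seminorm_2 k a + seminorm_2 k b"
      using assms that by (intro add_mono L2_set_le_seminorm_2)
    finally show ?thesis .
  qed
  note bound = this
  show "seminorm_finite k (\<lambda>n. a n + b n)"
    using bound by (rule seminorm_2_le(1))
  show "seminorm_2 k (\<lambda>n. a n + b n) \<le> seminorm_2 k a + seminorm_2 k b"
    using bound by (rule seminorm_2_le(2))
qed

lemma seminorm_finite_diff:
  assumes "seminorm_finite k a" and "seminorm_finite k b"
  shows "seminorm_finite k (\<lambda>n. a n - b n)"
  using seminorm_2_add(1)[of k a "\<lambda>n. - b n"] assms by (simp add: seminorm_finite_def)

lemma H_plus_seminorm_finite: "a \<in> H_plus \<Longrightarrow> 1 \<le> k \<Longrightarrow> seminorm_finite k a"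
  by (simp add: H_plus_def)

text \<open>The bound ln x <= x^e / e with e = 1/(2k) spends half of the decay n^(-1/k) on the
  logarithm; the other half is exactly the weight of index \<open>2 * k\<close>.\<close>

lemma ln_mult_powr_le:
  assumes "1 \<le> k" "1 \<le> n"
  shows "ln (real n) * real n powr (- 1 / real k) \<le> 2 * real k * real n powr (- 1 / real (2 * k))"
proof -
  have "ln (real n) \<le> real n powr (1 / real (2 * k)) / (1 / real (2 * k))"
    using assms by (intro ln_powr_bound) auto
  then have "ln (real n) * real n powr (- 1 / real k)
      \<le> 2 * real k * real n powr (1 / real (2 * k)) * real n powr (- 1 / real k)"
    by (intro mult_right_mono) (auto simp: mult_ac)
  also have "\<dots> = 2 * real k * real n powr (1 / real (2 * k) + - 1 / real k)"
    by (simp only: powr_add mult.assoc)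
  also have "1 / real (2 * k) + - 1 / real k = - 1 / real (2 * k)"
    using assms by (simp add: field_simps)
  finally show ?thesis .
qed

lemma seminorm_2_diff_op:
  assumes "1 \<le> k" and "seminorm_finite (2 * k) a"
  shows "seminorm_finite k (diff_op a)"
    and "seminorm_2 k (diff_op a) \<le> 2 * real k * seminorm_2 (2 * k) a"
proof -
  have "cmod (diff_op a n) * real n powr (- 1 / real k)
      \<le> 2 * real k * (cmod (a n) * real n powr (- 1 / real (2 * k)))" if "1 \<le> n" for n
  proof -
    \<comment> \<open>At \<open>n = 1\<close> the operator returns 0 by definition and the logarithm
      vanishes as well.\<close>
    have "cmod (diff_op a n) \<le> cmod (a n) * ln (real n)"
      using that by (simp add: diff_op_def norm_mult)
    then have "cmod (diff_op a n) * real n powr (- 1 / real k)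
        \<le> cmod (a n) * (ln (real n) * real n powr (- 1 / real k))"
      by (simp add: mult_right_mono flip: mult.assoc)
    also have "\<dots> \<le> cmod (a n) * (2 * real k * real n powr (- 1 / real (2 * k)))"
      using ln_mult_powr_le[OF assms(1) that] by (intro mult_left_mono) auto
    finally show ?thesis
      by (simp only: mult_ac)
  qed
  then show "seminorm_finite k (diff_op a)"
    and "seminorm_2 k (diff_op a) \<le> 2 * real k * seminorm_2 (2 * k) a"
    using seminorm_2_dominated[OF assms(2), of "2 * real k" "diff_op a" k] by simp_all
qed

lemma diff_op_in_H_plus: "a \<in> H_plus \<Longrightarrow> diff_op a \<in> H_plus"
  by (auto simp: H_plus_def dirichlet_series_def seminorm_2_diff_op(1))
    (simp add: diff_op_def)

lemma diff_op_diff: "diff_op (\<lambda>n. a n - b n) = (\<lambda>n. diff_op a n - diff_op b n)"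
  by (auto simp: diff_op_def algebra_simps)

lemma openin_H_plus_ball:
  "1 \<le> k \<Longrightarrow> a \<in> H_plus \<Longrightarrow> 0 < r \<Longrightarrow> openin H_plus_topology (H_plus_ball k a r)"
  unfolding H_plus_topology_def by (rule topology_generated_by_Basis) blast

text \<open>The target ball is centred at an arbitrary \<open>a\<close> rather than at
  \<open>diff_op b\<close>, since the subbasis contains all such balls; the triangle inequality
  absorbs the offset.\<close>

lemma diff_op_vimage_ball:
  assumes "1 \<le> k" "a \<in> H_plus" "b \<in> H_plus" "diff_op b \<in> H_plus_ball k a r"
  obtains e where "0 < e" "diff_op ` H_plus_ball (2 * k) b e \<subseteq> H_plus_ball k a r"
proof
  define s where "s = seminorm_2 k (\<lambda>n. diff_op b n - a n)"
  \<comment> \<open>The room left around \<open>diff_op b\<close> inside the ball, divided by the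
    bound \<open>2 * real k\<close> of the operator.\<close>
  define e where "e = (r - s) / (2 * real k)"
  show "0 < e"
    using assms unfolding e_def s_def H_plus_ball_def by simp
  show "diff_op ` H_plus_ball (2 * k) b e \<subseteq> H_plus_ball k a r"
  proof (intro image_subsetI)
    fix c assume c: "c \<in> H_plus_ball (2 * k) b e"
    then have "c \<in> H_plus" and dist: "seminorm_2 (2 * k) (\<lambda>n. c n - b n) < e"
      by (auto simp: H_plus_ball_def)
    have fin: "seminorm_finite (2 * k) (\<lambda>n. c n - b n)"
      using \<open>c \<in> H_plus\<close> assms by (intro seminorm_finite_diff H_plus_seminorm_finite) auto
    have fin': "seminorm_finite k (\<lambda>n. diff_op b n - a n)"
      using assms by (intro seminorm_finite_diff H_plus_seminorm_finite diff_op_in_H_plus)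
    \<comment> \<open>By linearity the distance to \<open>a\<close> splits at
      \<open>diff_op b\<close>: one part is the image of \<open>c - b\<close>, the other has
      seminorm \<open>s\<close>.\<close>
    have "seminorm_2 k (\<lambda>n. diff_op c n - a n)
        = seminorm_2 k (\<lambda>n. diff_op (\<lambda>n. c n - b n) n + (diff_op b n - a n))"
      by (simp add: diff_op_diff)
    also have "\<dots> \<le> seminorm_2 k (diff_op (\<lambda>n. c n - b n)) + s"
      unfolding s_def using seminorm_2_diff_op(1)[OF assms(1) fin] fin' by (rule seminorm_2_add)
    also have "\<dots> \<le> 2 * real k * seminorm_2 (2 * k) (\<lambda>n. c n - b n) + s"
      using seminorm_2_diff_op(2)[OF assms(1) fin] by simp
    also have "\<dots> < 2 * real k * e + s"
      using dist assms(1) by simp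
    also have "\<dots> = r"
      using assms(1) by (simp add: e_def)
    finally show "diff_op c \<in> H_plus_ball k a r"
      using \<open>c \<in> H_plus\<close> by (simp add: H_plus_ball_def diff_op_in_H_plus)
  qed
qed

text \<open>It suffices to treat preimages of subbasic balls; each is open because it contains a
  ball around each of its points.\<close>

lemma continuous_map_diff_op: "continuous_map H_plus_topology H_plus_topology diff_op"
proof -
  have "openin H_plus_topology (diff_op -` H_plus_ball k a r \<inter> H_plus)"
    if "1 \<le> k" "a \<in> H_plus" for k a r
  proof (subst openin_subopen, intro ballI)
    fix b assume b: "b \<in> diff_op -` H_plus_ball k a r \<inter> H_plus"
    then obtain e where e: "0 < e" "diff_op ` H_plus_ball (2 * k) b e \<subseteq> H_plus_ball k a r"
      using diff_op_vimage_ball[of k a b r] \<open>1 \<le> k\<close> \<open>a \<in> H_plus\<close> by auto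
    moreover have "openin H_plus_topology (H_plus_ball (2 * k) b e)"
      using b e \<open>1 \<le> k\<close> by (intro openin_H_plus_ball) auto
    moreover have "b \<in> H_plus_ball (2 * k) b e"
      using b e by (simp add: H_plus_ball_def seminorm_2_def)
    moreover have "H_plus_ball (2 * k) b e \<subseteq> H_plus"
      by (auto simp: H_plus_ball_def)
    ultimately show "\<exists>T. openin H_plus_topology T \<and> b \<in> T \<and>
        T \<subseteq> diff_op -` H_plus_ball k a r \<inter> H_plus"
      by (intro exI[of _ "H_plus_ball (2 * k) b e"]) auto
  qed
  moreover have "diff_op ` H_plus \<subseteq>
      \<Union>{H_plus_ball k a r | k a r. k \<ge> 1 \<and> a \<in> H_plus \<and> r > 0}"
    using topspace_H_plus_topology diff_op_in_H_plus
    unfolding H_plus_topology_def topology_generated_by_topspace by blast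
  ultimately show ?thesis
    \<comment> \<open>Only the target topology is unfolded, so that the carrier of the source still
      simplifies to \<open>H_plus\<close>.\<close>
    by (subst (2) H_plus_topology_def) (rule continuous_on_generated_topo, auto)
qed

lemma diff_op_surj:
  assumes "a \<in> H_plus_0"
  shows "a \<in> diff_op ` H_plus"
proof
  \<comment> \<open>Termwise antiderivative. The value at 0 is forced by the encoding of series; the
    one at 1 is a free choice, as differentiation kills constants.\<close>
  define b where "b = (\<lambda>n. if n \<ge> 2 then - (a n / of_real (ln (real n))) else 0)"
  have a: "a \<in> H_plus" "a 0 = 0" "a 1 = 0"
    using assms by (auto simp: H_plus_0_def H_plus_def dirichlet_series_def)
  show "a = diff_op b"
  proof
    fix n
    show "a n = diff_op b n"
    proof (cases "n \<ge> 2")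
      case True
      then show ?thesis by (simp add: diff_op_def b_def)
    next
      case False
      \<comment> \<open>Here \<open>a 1 = 0\<close> enters: \<open>diff_op b\<close> vanishes at 0
        and 1, so \<open>a\<close> must too.\<close>
      then have "n = 0 \<or> n = 1" by auto
      then show ?thesis using a by (auto simp: diff_op_def)
    qed
  qed
  have b_le: "cmod (b n) \<le> 1 / ln 2 * cmod (a n)" for n
    using mult_right_mono[of "ln 2" "ln (real n)" "cmod (a n)"]
    by (auto simp: b_def norm_divide field_simps intro!: mult_left_mono)
  have "seminorm_finite k b" if "1 \<le> k" for k
  proof (rule seminorm_2_dominated(1))
    show "seminorm_finite k a"
      using a(1) that by (rule H_plus_seminorm_finite)
    show "cmod (b n) * real n powr (- 1 / real k)
        \<le> 1 / ln 2 * (cmod (a n) * real n powr (- 1 / real k))" for n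
      using mult_right_mono[OF b_le] by (simp add: mult.assoc)
  qed simp
  then show "b \<in> H_plus"
    by (simp add: H_plus_def dirichlet_series_def b_def)
qed

theorem proposition6p1:
  "diff_op \<in> H_plus \<rightarrow> H_plus
   \<and> continuous_map H_plus_topology H_plus_topology diff_op
   \<and> diff_op ` H_plus = H_plus_0"
proof (intro conjI)
  show "diff_op \<in> H_plus \<rightarrow> H_plus"
    by (simp add: diff_op_in_H_plus)
  show "continuous_map H_plus_topology H_plus_topology diff_op"
    by (rule continuous_map_diff_op)
  \<comment> \<open>This gives the inclusion of the range in \<open>H_plus_0\<close>; the reverse
    one is \<open>diff_op_surj\<close>.\<close>
  have "diff_op a 1 = 0" for a
    by (simp add: diff_op_def)
  then show "diff_op ` H_plus = H_plus_0"
    using diff_op_in_H_plus diff_op_surj by (auto simp: H_plus_0_def)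
qed

end
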